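(* Let $\mathbb{K}$ be an algebraically closed field of characteristic zero, $A=\mathbb{K}[x_1,\dots,x_n]$, $R=\mathbb{K}(x_1,\dots,x_n)$, and $W_n(\mathbb{K})=\mathrm{Der}_{\mathbb{K}}(A)$. Let $D=\sum_{i,j=1}^n a_{ij}x_j\,\partial_i\in W_n(\mathbb{K})$ (with $a_{ij}\in\mathbb{K}$) be a linear derivation, and let $F=\{r\in R : D(r)=0\}$ be the field of constants of (the extension of) $D$ in $R$. Let $C_{\mathfrak{gl}_n}(D)$ and $C_{W_n}(D)$ be the centralizers of $D$ in $\mathfrak{gl}_n(\mathbb{K})\subset W_n(\mathbb{K})$ and in $W_n(\mathbb{K})$, respectively. Then $$C_{W_n}(D)=\bigl(F\,C_{\mathfrak{gl}_n}(D)\bigr)\cap W_n(\mathbb{K}).$$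
   Context: $\partial_i=\partial/\partial x_i$. $W_n(\mathbb{K})$ is a Lie algebra under the commutator; its elements are uniquely of the form $\sum_i f_i\partial_i$ with $f_i\in A$. Every derivation of $A$ extends uniquely to a derivation of $R$ (denoted by the same letter). The Lie algebra of all $\mathbb{K}$-derivations of $R$ is denoted $\widetilde W_n(\mathbb{K})$; its elements are uniquely $\sum_i \varphi_i\partial_i$ with $\varphi_i\in R$, and $W_n(\mathbb{K})\subset\widetilde W_n(\mathbb{K})$. A derivation is linear if it has the form $\sum_{i,j}b_{ij}x_j\partial_i$ with $b_{ij}\in\mathbb{K}$; the Lie algebra of all linear derivations is identified with $\mathfrak{gl}_n(\mathbb{K})\subset W_n(\mathbb{K})$. The centralizer of $D$ in a Lie subalgebra $L$ is $\{T\in L : [T,D]=0\}$. $F\,C_{\mathfrak{gl}_n}(D)$ denotes the $F$-linear span of $C_{\mathfrak{gl}_n}(D)$ inside $\widetilde W_n(\mathbb{K})$. *)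

theory Defs
  imports
    "HOL-Library.Poly_Mapping"
    "HOL-Computational_Algebra.Computational_Algebra"
begin

text \<open>
  The variables are indexed by a finite type \<open>'n\<close>, so that \<open>n = CARD('n)\<close>. The linear order on
  \<open>'n\<close> plays no mathematical role: it only induces the monomial order from which the library
  derives that the polynomial ring is an integral domain.
\<close>

type_synonym ('n, 'k) mpoly = "('n \<Rightarrow>\<^sub>0 nat) \<Rightarrow>\<^sub>0 'k"
type_synonym ('n, 'k) ratfun = "('n, 'k) mpoly fract"

definition Const :: "'k::zero \<Rightarrow> ('n, 'k) mpoly" where
  "Const c = Poly_Mapping.single 0 c"

definition Var :: "'n \<Rightarrow> ('n, 'k::zero_neq_one) mpoly" where
  "Var i = Poly_Mapping.single (Poly_Mapping.single i 1) 1"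

definition ConstR :: "'k::field \<Rightarrow> ('n::linorder, 'k) ratfun" where
  "ConstR c = to_fract (Const c)"


subsection \<open>Derivations\<close>

text \<open>Derivations of a commutative algebra whose structure map is \<open>\<iota>\<close>.\<close>

definition derivation :: "('k \<Rightarrow> 'r::comm_ring_1) \<Rightarrow> ('r \<Rightarrow> 'r) \<Rightarrow> bool" where
  "derivation \<iota> d \<longleftrightarrow>
     (\<forall>p q. d (p + q) = d p + d q) \<and>
     (\<forall>c p. d (\<iota> c * p) = \<iota> c * d p) \<and>
     (\<forall>p q. d (p * q) = d p * q + p * d q)"

definition lie_bracket :: "('r::ab_group_add \<Rightarrow> 'r) \<Rightarrow> ('r \<Rightarrow> 'r) \<Rightarrow> 'r \<Rightarrow> 'r" where
  "lie_bracket S T = (\<lambda>p. S (T p) - T (S p))"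

definition centralizer :: "('r::ab_group_add \<Rightarrow> 'r) set \<Rightarrow> ('r \<Rightarrow> 'r) \<Rightarrow> ('r \<Rightarrow> 'r) set" where
  "centralizer L D = {T \<in> L. lie_bracket T D = (\<lambda>_. 0)}"

definition W :: "(('n, 'k::field) mpoly \<Rightarrow> ('n, 'k) mpoly) set" where
  "W = {d. derivation Const d}"

definition W_tilde :: "(('n::linorder, 'k::field) ratfun \<Rightarrow> ('n, 'k) ratfun) set" where
  "W_tilde = {d. derivation ConstR d}"

text \<open>
  Subtraction of exponents is truncated, but whenever truncation happens the coefficient
  \<open>of_nat (lookup m i)\<close> is zero.
\<close>

definition partial_deriv :: "'n \<Rightarrow> ('n, 'k::field) mpoly \<Rightarrow> ('n, 'k) mpoly" where
  "partial_deriv i p =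
     (\<Sum>m\<in>Poly_Mapping.keys p.
        Poly_Mapping.single (m - Poly_Mapping.single i 1)
          (of_nat (Poly_Mapping.lookup m i) * Poly_Mapping.lookup p m))"

definition linear_derivation ::
  "('n::finite \<Rightarrow> 'n \<Rightarrow> 'k::field) \<Rightarrow> ('n, 'k) mpoly \<Rightarrow> ('n, 'k) mpoly" where
  "linear_derivation b = (\<lambda>p. \<Sum>i\<in>UNIV. \<Sum>j\<in>UNIV. Const (b i j) * Var j * partial_deriv i p)"

definition gl :: "(('n::finite, 'k::field) mpoly \<Rightarrow> ('n, 'k) mpoly) set" where
  "gl = range linear_derivation"

lemma partial_deriv_superset:
  assumes "finite A" "Poly_Mapping.keys p \<subseteq> A"
  shows "partial_deriv i p =
    (\<Sum>m\<in>A. Poly_Mapping.single (m - Poly_Mapping.single i 1)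
       (of_nat (Poly_Mapping.lookup m i) * Poly_Mapping.lookup p m))"
  unfolding partial_deriv_def
  by (rule sum.mono_neutral_left) (use assms in \<open>auto simp: in_keys_iff\<close>)

lemma partial_deriv_add: "partial_deriv i (p + q) = partial_deriv i p + partial_deriv i q"
proof -
  let ?A = "Poly_Mapping.keys p \<union> Poly_Mapping.keys q"
  have "Poly_Mapping.keys (p + q) \<subseteq> ?A"
    by (rule Poly_Mapping.keys_add)
  then show ?thesis
    by (simp add: partial_deriv_superset[of ?A] lookup_add distrib_left single_add sum.distrib)
qed

lemma partial_deriv_single:
  "partial_deriv i (Poly_Mapping.single m c) =
     Poly_Mapping.single (m - Poly_Mapping.single i 1) (of_nat (Poly_Mapping.lookup m i) * c)"
  by (subst partial_deriv_superset[of "{m}"]) auto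

lemma partial_deriv_Var: "partial_deriv i (Var j) = (if i = j then 1 else 0)"
  by (auto simp: Var_def partial_deriv_single lookup_single single_one)

lemma mpoly_induct [case_names zero add_single]:
  fixes p :: "('n, 'k::field) mpoly"
  assumes "P 0" and "\<And>m c p. P p \<Longrightarrow> P (Poly_Mapping.single m c + p)"
  shows "P p"
proof (induction p rule: update_induct)
  case const
  then show ?case by (rule assms(1))
next
  case (update p m c)
  have "Poly_Mapping.update m c p = Poly_Mapping.single m c + p"
    using update(1)
    by (intro poly_mapping_eqI)
       (auto simp: lookup_update lookup_add lookup_single in_keys_iff when_def)
  then show ?case using assms(2)[OF update(3)] by simp
qed

lemma partial_deriv_0 [simp]: "partial_deriv i 0 = 0"
  by (simp add: partial_deriv_def)

lemma partial_deriv_mult_single: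
  fixes i :: 'n
  shows "partial_deriv i (Poly_Mapping.single m c * Poly_Mapping.single l e) =
     partial_deriv i (Poly_Mapping.single m c) * Poly_Mapping.single l e +
     Poly_Mapping.single m c * partial_deriv i (Poly_Mapping.single l e)"
proof -
  let ?e = "Poly_Mapping.single i 1 :: 'n \<Rightarrow>\<^sub>0 nat"
  have shift: "k - ?e + h = k + h - ?e" if "Poly_Mapping.lookup k i \<noteq> 0" for k h
    using that by (intro poly_mapping_eqI) (auto simp: lookup_add lookup_minus lookup_single when_def)
  have left: "Poly_Mapping.single (m - ?e + l) (of_nat (Poly_Mapping.lookup m i) * (c * e)) =
      Poly_Mapping.single (m + l - ?e) (of_nat (Poly_Mapping.lookup m i) * (c * e))"
    using shift[of m l] by (cases "Poly_Mapping.lookup m i = 0") (simp_all del: One_nat_def)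
  have right: "Poly_Mapping.single (m + (l - ?e)) (of_nat (Poly_Mapping.lookup l i) * (c * e)) =
      Poly_Mapping.single (m + l - ?e) (of_nat (Poly_Mapping.lookup l i) * (c * e))"
    using shift[of l m]
    by (cases "Poly_Mapping.lookup l i = 0") (simp_all add: add.commute del: One_nat_def)
  show ?thesis
    using left right
    by (simp add: partial_deriv_single mult_single lookup_add ac_simps single_add[symmetric]
        distrib_right distrib_left)
qed

lemma partial_deriv_mult:
  "partial_deriv i (p * q) = partial_deriv i p * q + p * partial_deriv i q"
proof (induction p rule: mpoly_induct)
  case zero
  then show ?case by simp
next
  case (add_single m c p)
  have "partial_deriv i (Poly_Mapping.single m c * q) =
     partial_deriv i (Poly_Mapping.single m c) * q +
     Poly_Mapping.single m c * partial_deriv i q"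
    by (induction q rule: mpoly_induct)
       (simp_all add: distrib_left partial_deriv_add partial_deriv_mult_single algebra_simps)
  with add_single show ?case
    by (simp add: distrib_right partial_deriv_add algebra_simps)
qed

lemma partial_deriv_Const [simp]: "partial_deriv i (Const c) = 0"
  by (simp add: Const_def partial_deriv_single)

lemma gl_subset_W: "gl \<subseteq> W"
  by (auto simp: gl_def W_def derivation_def linear_derivation_def partial_deriv_add
      partial_deriv_mult distrib_left sum.distrib sum_distrib_left sum_distrib_right mult_ac)


subsection \<open>Extension to rational functions\<close>

definition extend ::
  "(('n::linorder, 'k::field) mpoly \<Rightarrow> ('n, 'k) mpoly) \<Rightarrow> ('n, 'k) ratfun \<Rightarrow> ('n, 'k) ratfun" where
  "extend d = (THE E. E \<in> W_tilde \<and> (\<forall>p. E (to_fract p) = to_fract (d p)))"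

text \<open>The description in \<open>extend\<close> is proper: derivations of the polynomial ring extend uniquely to its fraction field.\<close>

lemma ex1_extension:
  fixes d :: "('n::linorder, 'k::field) mpoly \<Rightarrow> ('n, 'k) mpoly"
  assumes "d \<in> W"
  shows "\<exists>!E. E \<in> W_tilde \<and> (\<forall>p. E (to_fract p) = to_fract (d p))"
proof -
  have add: "d (p + q) = d p + d q" and lin: "d (Const c * p) = Const c * d p"
    and leibniz: "d (p * q) = d p * q + p * d q" for p q c
    using assms by (auto simp: W_def derivation_def)
  have one: "d 1 = 0"
    using leibniz[of 1 1] by (metis add_cancel_right_right mult_1_left mult_1_right)
  have indep: "Fract (d p * q - p * d q) (q * q) = Fract (d p' * q' - p' * d q') (q' * q')"
    if "q \<noteq> 0" "q' \<noteq> 0" "Fract p q = Fract p' q'" for p q p' q'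
  proof -
    have eq: "p * q' = p' * q"
      using that by (simp add: eq_fract)
    then have "d p * q' + p * d q' = d p' * q + p' * d q"
      using leibniz by metis
    with eq have "(d p * q - p * d q) * (q' * q') = (d p' * q' - p' * d q') * (q * q)"
      by algebra
    with that show ?thesis
      by (simp add: eq_fract)
  qed
  have "\<exists>p q. q \<noteq> 0 \<and> r = Fract p q" for r :: "('n, 'k) ratfun"
    by (cases r) auto
  then obtain num den where rep: "\<And>r. den r \<noteq> 0" "\<And>r :: ('n, 'k) ratfun. r = Fract (num r) (den r)"
    by metis
  define E where
    "E = (\<lambda>r. Fract (d (num r) * den r - num r * d (den r)) (den r * den r))"
  have E: "E (Fract p q) = Fract (d p * q - p * d q) (q * q)" if "q \<noteq> 0" for p q
    unfolding E_def by (rule indep) (use that rep in auto)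
  have E_add: "E (r + s) = E r + E s" and E_mult: "E (r * s) = E r * s + r * E s" for r s
  proof -
    obtain p q where r: "r = Fract p q" "q \<noteq> 0" by (cases r) auto
    obtain t u where s: "s = Fract t u" "u \<noteq> 0" by (cases s) auto
    show "E (r + s) = E r + E s"
      using r s by (simp add: E eq_fract add leibniz algebra_simps)
    show "E (r * s) = E r * s + r * E s"
      using r s by (simp add: E eq_fract add leibniz algebra_simps)
  qed
  have E_to_fract: "E (to_fract p) = to_fract (d p)" for p
    by (simp add: to_fract_def E one)
  have "d (Const c) = 0" for c
    using lin[of c 1] by (simp add: one)
  then have "E (ConstR c) = 0" for c
    by (simp add: ConstR_def E_to_fract)
  then have E_lin: "E (ConstR c * r) = ConstR c * E r" for c r
    by (simp add: E_mult)
  show ?thesis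
  proof (rule ex1I[of _ E])
    show "E \<in> W_tilde \<and> (\<forall>p. E (to_fract p) = to_fract (d p))"
      unfolding W_tilde_def derivation_def mem_Collect_eq
      using E_add E_lin E_mult E_to_fract by blast
  next
    fix G
    assume G: "G \<in> W_tilde \<and> (\<forall>p. G (to_fract p) = to_fract (d p))"
    show "G = E"
    proof
      fix r :: "('n, 'k) ratfun"
      obtain p q where r: "r = Fract p q" "q \<noteq> 0" by (cases r) auto
      have q: "to_fract q \<noteq> 0" using r by (simp add: to_fract_def eq_fract Zero_fract_def)
      have rq: "r * to_fract q = to_fract p"
        using r by (simp add: to_fract_def eq_fract)
      have "G (r * to_fract q) = G r * to_fract q + r * G (to_fract q)"
        using G by (auto simp: W_tilde_def derivation_def)
      moreover have "E (r * to_fract q) = E r * to_fract q + r * E (to_fract q)"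
        by (rule E_mult)
      ultimately have "G r * to_fract q = E r * to_fract q"
        using G by (simp add: rq E_to_fract)
      with q show "G r = E r" by simp
    qed
  qed
qed

lemma extend_W:
  assumes "d \<in> W"
  shows "extend d \<in> W_tilde" "extend d (to_fract p) = to_fract (d p)"
  using theI'[OF ex1_extension[OF assms]] by (auto simp: extend_def)

definition constants :: "('r \<Rightarrow> 'r::zero) \<Rightarrow> 'r set" where
  "constants d = {r. d r = 0}"

text \<open>Linear span of \<open>S\<close> with scalars taken from \<open>F\<close>, acting on operators by multiplication of values.\<close>

definition span_over :: "'r::comm_ring_1 set \<Rightarrow> ('r \<Rightarrow> 'r) set \<Rightarrow> ('r \<Rightarrow> 'r) set" where
  "span_over F S =
     {(\<lambda>r. \<Sum>T\<in>I. \<phi> T * T r) | I \<phi>. finite I \<and> I \<subseteq> S \<and> (\<forall>T\<in>I. \<phi> T \<in> F)}"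

end

theory Submission
  imports Defs "HOL-Analysis.Cartesian_Space"
begin

text \<open>
  Write a derivation \<open>T\<close> of the polynomial ring as the column \<open>f\<close> of its values on the variables.
  Then \<open>T\<close> commutes with \<open>D\<close> iff \<open>D f = A f\<close> entrywise, and the linear derivations commuting with
  \<open>D\<close> correspond to the columns \<open>C x\<close> with \<open>C A = A C\<close>, where \<open>x\<close> is the column of
  variables. As \<open>x\<close> is generic, its annihilator over the rational functions is that of \<open>A\<close>, so the
  cyclic module generated by \<open>x\<close> has an \<open>A\<close>-invariant complement and every column \<open>f\<close> is \<open>B x\<close>
  for some matrix \<open>B\<close> of rational functions commuting with \<open>A\<close>. Expanding \<open>B\<close> over the ground
  field, \<open>f\<close> is a combination of columns \<open>C x\<close> as above. Choosing these columns
  linearly independent and applying \<open>D - A\<close> shows that the coefficients are constants of \<open>D\<close>.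
\<close>

subsection \<open>Polynomials in a matrix\<close>

text \<open>Horner's scheme for \<open>p(A) v\<close>. Acting on a vector avoids matrix powers;
  \<open>p(A) = 0\<close> is expressed as vanishing on all vectors.\<close>

definition poly_app :: "'a::field^'n^'n \<Rightarrow> 'a poly \<Rightarrow> 'a^'n \<Rightarrow> 'a^'n" where
  "poly_app A p v = fold_coeffs (\<lambda>c w. c *s v + A *v w) p 0"

lemma poly_app_0 [simp]: "poly_app A 0 v = 0"
  by (simp add: poly_app_def)

lemma poly_app_pCons [simp]: "poly_app A (pCons c p) v = c *s v + A *v poly_app A p v"
proof (cases "p = 0")
  case True
  then show ?thesis by (cases "c = 0") (simp_all add: poly_app_def)
next
  case False
  then show ?thesis by (simp add: poly_app_def)
qed

lemma poly_app_1 [simp]: "poly_app A 1 v = v"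
  by (simp add: one_pCons)

lemma poly_app_add: "poly_app A (p + q) v = poly_app A p v + poly_app A q v"
  by (induction p q rule: poly_induct2)
     (simp_all add: vec.add algebra_simps)

lemma poly_app_smult: "poly_app A (smult c p) v = c *s poly_app A p v"
  by (induction p) (simp_all add: vec.scale vector_ssub_ldistrib vec.scale_right_distrib)

lemma poly_app_diff: "poly_app A (p - q) v = poly_app A p v - poly_app A q v"
  using poly_app_add[of A "p - q" q v] by (simp add: algebra_simps)

lemma poly_app_mult: "poly_app A (p * q) v = poly_app A p (poly_app A q v)"
  by (induction p) (simp_all add: poly_app_add poly_app_smult)

lemma poly_app_vec_add: "poly_app A p (v + w) = poly_app A p v + poly_app A p w"
  by (induction p) (simp_all add: vec.add algebra_simps vec.scale_right_distrib)

lemma poly_app_vec_scale: "poly_app A p (c *s v) = c *s poly_app A p v"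
  by (induction p) (simp_all add: vec.scale vec.scale_right_distrib mult.commute)

lemma poly_app_vec_0 [simp]: "poly_app A p 0 = 0"
  using poly_app_vec_scale[of A p 0 0] by simp

lemma poly_app_vec_diff: "poly_app A p (v - w) = poly_app A p v - poly_app A p w"
  using poly_app_vec_add[of A p "v - w" w] by (simp add: algebra_simps)

lemma poly_app_sum: "poly_app A (\<Sum>i\<in>I. f i) v = (\<Sum>i\<in>I. poly_app A (f i) v)"
  by (induction I rule: infinite_finite_induct) (simp_all add: poly_app_add)

lemma poly_app_vec_sum: "poly_app A p (\<Sum>i\<in>I. f i) = (\<Sum>i\<in>I. poly_app A p (f i))"
  by (induction I rule: infinite_finite_induct) (simp_all add: poly_app_vec_add)

lemma poly_app_X [simp]: "poly_app A [:0, 1:] v = A *v v"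
  by simp

text \<open>The vectors \<open>v, A v, ..., A^n v\<close> are too many to be independent. Dependence
  is a property of sets, so coinciding powers form a separate case.\<close>

lemma exists_annihilating_poly:
  fixes A :: "'a::field^'n^'n"
  shows "\<exists>p. p \<noteq> 0 \<and> poly_app A p v = 0"
proof -
  define w where "w k = poly_app A (monom 1 k) v" for k
  show ?thesis
  proof (cases "inj_on w {..CARD('n)}")
    case False
    then obtain i j where ij: "i \<noteq> j" "w i = w j" by (auto simp: inj_on_def)
    from ij have "coeff (monom 1 i - monom (1::'a) j) i \<noteq> 0" by simp
    then have "monom 1 i - monom (1::'a) j \<noteq> 0" by force
    moreover have "poly_app A (monom 1 i - monom 1 j) v = 0"
      using ij by (simp add: poly_app_diff w_def)
    ultimately show ?thesis by blast
  next
    case True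
    let ?S = "w ` {..CARD('n)}"
    have "card ?S = Suc (CARD('n))" using True by (simp add: card_image)
    then have "vec.dependent ?S"
      using vec.dependent_biggerset_general[of ?S] vec.dim_subset_UNIV[of ?S]
      by (simp add: vec.dimension_def card_cart_basis)
    then obtain u k where u: "k \<le> CARD('n)" "u (w k) \<noteq> 0" "(\<Sum>v\<in>?S. u v *s v) = 0"
      by (auto simp: vec.dependent_finite)
    let ?p = "\<Sum>k\<le>CARD('n). monom (u (w k)) k"
    have "coeff ?p k = u (w k)"
      using u(1) by (simp add: coeff_sum if_distrib cong: if_cong)
    then have "?p \<noteq> 0" using u(2) by force
    moreover have "poly_app A ?p v = (\<Sum>k\<le>CARD('n). u (w k) *s w k)"
      unfolding poly_app_sum w_def
      by (intro sum.cong refl) (simp add: poly_app_smult[symmetric] smult_monom)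
    moreover have "\<dots> = (\<Sum>v\<in>?S. u v *s v)"
      using True by (simp add: sum.reindex)
    ultimately show ?thesis using u(3) by auto
  qed
qed

section \<open>Invariant complements of cyclic subspaces\<close>

text \<open>A basis of \<open>S\<close> stays independent after adding \<open>w\<close>, so a
  functional can be prescribed as 0 on the basis and 1 at \<open>w\<close>.\<close>

lemma separating_functional:
  fixes w :: "'a::field^'n"
  assumes "vec.subspace S" "w \<notin> S"
  shows "\<exists>l. Vector_Spaces.linear (*s) (*) l \<and> (\<forall>v\<in>S. l v = 0) \<and> l w \<noteq> 0"
proof -
  obtain B where B: "B \<subseteq> S" "vec.independent B" "S \<subseteq> vec.span B"
    using vec.maximal_independent_subset by blast
  have "vec.span B = S"
    using B assms vec.span_minimal by blast
  then have ind: "vec.independent (insert w B)"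
    using assms B by (simp add: vec.independent_insertI)
  interpret pr: vector_space_pair "(*s) :: 'a \<Rightarrow> 'a^'n \<Rightarrow> _" "(*) :: 'a \<Rightarrow> 'a \<Rightarrow> 'a" ..
  obtain g where g: "Vector_Spaces.linear (*s) (*) g" "\<forall>x\<in>insert w B. g x = (if x = w then 1 else 0)"
    using pr.linear_independent_extend[OF ind, of "\<lambda>x. if x = w then 1 else 0"] by blast
  have "w \<notin> B" using assms B by auto
  then have "g v = 0" if "v \<in> S" for v
    using pr.linear_eq_0_on_span[OF g(1), of B v] g(2) that B by (metis insertCI subsetD)
  then show ?thesis using g by auto
qed

text \<open>
  The powers of \<open>A\<close> span a cyclic subspace through \<open>x\<close> of the largest possible dimension \<open>d\<close>. A
  functional \<open>l\<close> vanishing on \<open>x, \<dots>, A\<^sup>d\<^sup>-\<^sup>2 x\<close> but not on \<open>A\<^sup>d\<^sup>-\<^sup>1 x\<close> cuts out an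
  \<open>A\<close>-invariant complement \<open>U\<close>; the matrix \<open>B\<close> kills \<open>U\<close> and sends \<open>q(A) x\<close> to \<open>q(A) f\<close>.
\<close>

lemma exists_commuting_matrix:
  fixes A :: "'a::field^'n^'n"
  assumes ann: "\<And>p v. poly_app A p x = 0 \<Longrightarrow> poly_app A p v = 0"
  shows "\<exists>B. A ** B = B ** A \<and> B *v x = f"
proof -
  let ?P = "\<lambda>d. \<exists>p. p \<noteq> 0 \<and> degree p = d \<and> poly_app A p x = 0"
  \<comment> \<open>\<open>d\<close> is the degree of the minimal polynomial of \<open>x\<close>
    with respect to \<open>A\<close>, hence the dimension of the cyclic subspace.\<close>
  define d where "d = (LEAST d. ?P d)"
  have "?P d" unfolding d_def by (rule LeastI_ex) (use exists_annihilating_poly in blast)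
  then obtain p where p: "p \<noteq> 0" "degree p = d" "poly_app A p x = 0" by blast
  have small: "q = 0" if "poly_app A q x = 0" "degree q < d" for q
    using that not_less_Least[of "degree q" ?P] unfolding d_def by blast
  show ?thesis
  proof (cases "d = 0")
    \<comment> \<open>A nonzero constant kills \<open>x\<close>, hence by \<open>ann\<close> also
      \<open>f\<close>, so the zero matrix serves. In the other case \<open>d - 1\<close> is not
      truncated.\<close>
    case True
    then obtain c where "p = [:c:]" "c \<noteq> 0" using p by (metis degree_0_id pCons_eq_0_iff)
    then have "f = 0" using ann[OF p(3), of f] by simp
    then show ?thesis by (intro exI[of _ 0]) simp
  next
    case False
    let ?X = "\<lambda>i. monom (1::'a) i"
    define S where "S = {poly_app A q x | q. q = 0 \<or> degree q < d - 1}"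
    have S_I: "poly_app A q x \<in> S" if "q = 0 \<or> degree q < d - 1" for q
      using that unfolding S_def by blast
    have "vec.subspace S"
    proof (rule vec.subspaceI)
      show "0 \<in> S" using S_I[of 0] by simp
      fix u v assume "u \<in> S" "v \<in> S"
      then obtain q r where *: "u = poly_app A q x" "v = poly_app A r x"
         "q = 0 \<or> degree q < d - 1" "r = 0 \<or> degree r < d - 1" unfolding S_def by blast
      then have "q + r = 0 \<or> degree (q + r) < d - 1"
        by (metis add.left_neutral add.right_neutral degree_add_less)
      then show "u + v \<in> S" using S_I[of "q + r"] * by (simp add: poly_app_add)
    next
      fix c u assume "u \<in> S"
      then obtain q where *: "u = poly_app A q x" "q = 0 \<or> degree q < d - 1"
        unfolding S_def by blast
      then have "smult c q = 0 \<or> degree (smult c q) < d - 1" by auto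
      then show "c *s u \<in> S" using S_I[of "smult c q"] * by (simp add: poly_app_smult)
    qed
    moreover have "poly_app A (?X (d - 1)) x \<notin> S"
    proof
      assume "poly_app A (?X (d - 1)) x \<in> S"
      then obtain q where q: "poly_app A (?X (d - 1)) x = poly_app A q x" "q = 0 \<or> degree q < d - 1"
        unfolding S_def by blast
      have deg: "degree (?X (d - 1) - q) < d"
        using q(2) False by (intro degree_diff_less) (auto simp: degree_monom_eq)
      have "coeff q (d - 1) = 0" using q(2) by (auto simp: coeff_eq_0)
      then have "coeff (?X (d - 1) - q) (d - 1) = 1" by simp
      moreover have "?X (d - 1) - q = 0"
        using q(1) by (intro small deg) (simp add: poly_app_diff)
      ultimately show False by (metis coeff_0 zero_neq_one)
    qed
    ultimately obtain l where l: "Vector_Spaces.linear (*s) (*) l" "\<And>v. v \<in> S \<Longrightarrow> l v = 0"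
        "l (poly_app A (?X (d - 1)) x) \<noteq> 0"
      using separating_functional by blast
    interpret l: Vector_Spaces.linear "(*s)" "(*)" l by (rule l(1))
    define e where "e = l (poly_app A (?X (d - 1)) x)"
    have e: "e \<noteq> 0" using l(3) by (simp add: e_def)
    \<comment> \<open>Modulo \<open>S\<close> only the coefficient of degree \<open>d - 1\<close> is
      visible to \<open>l\<close>.\<close>
    have lead: "l (poly_app A q x) = coeff q (d - 1) * e" if "degree q < d" for q
    proof -
      let ?r = "q - smult (coeff q (d - 1)) (?X (d - 1))"
      have c: "coeff ?r (d - 1) = 0" by simp
      have "degree ?r \<le> d - 1"
        using that by (intro degree_diff_le) (auto intro: order.trans[OF degree_smult_le] degree_monom_le)
      then have "?r = 0 \<or> degree ?r < d - 1"
        using c by (metis leading_coeff_0_iff order_le_less)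
      then have "l (poly_app A ?r x) = 0" by (intro l(2) S_I)
      then show ?thesis
        by (simp add: poly_app_diff poly_app_smult l.diff l.scale e_def)
    qed
    \<comment> \<open>The largest \<open>A\<close>-invariant subspace inside the kernel of
      \<open>l\<close>.\<close>
    define U where "U = {u. \<forall>s. l (poly_app A s u) = 0}"
    have U_add: "u + v \<in> U" and U_diff: "u - v \<in> U" if "u \<in> U" "v \<in> U" for u v
      using that by (auto simp: U_def poly_app_vec_add poly_app_vec_diff l.add l.diff)
    have U_scale: "c *s u \<in> U" if "u \<in> U" for c u
      using that by (auto simp: U_def poly_app_vec_scale l.scale)
    have U_A: "A *v u \<in> U" if "u \<in> U" for u
    proof -
      have "l (poly_app A s (A *v u)) = 0" for s
      proof -
        have "l (poly_app A (s * [:0, 1:]) u) = 0" using that unfolding U_def by blast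
        then show ?thesis by (simp only: poly_app_mult poly_app_X)
      qed
      then show ?thesis unfolding U_def by blast
    qed
    \<comment> \<open>\<open>U\<close> meets the cyclic subspace only in 0: a nonzero remainder
      \<open>r\<close> modulo \<open>p\<close>, shifted up to degree \<open>d - 1\<close>, is
      detected by \<open>l\<close>. By \<open>ann\<close>, reduction modulo \<open>p\<close> is
      valid on every vector.\<close>
    have disj: "poly_app A q v = 0" if "poly_app A q x \<in> U" for q v
    proof -
      define r where "r = q mod p"
      have deg_r: "degree r < d" unfolding r_def using p False by (metis degree_mod_less' degree_0 neq0_conv)
      have "q = q div p * p + r" unfolding r_def by simp
      then have q: "poly_app A q w = poly_app A r w" for w
        by (metis ann add.left_neutral p(3) poly_app_add poly_app_mult poly_app_vec_0)
      have "r = 0"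
      proof (rule ccontr)
        assume r: "r \<noteq> 0"
        let ?s = "?X (d - 1 - degree r) * r"
        have "degree ?s = d - 1" using r deg_r by (simp add: degree_mult_eq degree_monom_eq monom_eq_0_iff)
        moreover have "coeff ?s (d - 1) = lead_coeff r"
          using deg_r by (simp add: coeff_monom_mult)
        ultimately have "l (poly_app A ?s x) = lead_coeff r * e"
          using lead[of ?s] False by simp
        moreover have "l (poly_app A ?s x) = 0"
          using that unfolding U_def q by (simp add: poly_app_mult)
        ultimately show False using r e by simp
      qed
      then show ?thesis using q by simp
    qed
    \<comment> \<open>A triangular system: adding a multiple of \<open>A^(d-1-k) x\<close> repairs
      condition \<open>k\<close> and preserves the earlier ones, because for \<open>i < k\<close>
      its image under \<open>A^i\<close> lies in \<open>S\<close>.\<close>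
    have ex: "\<exists>q. \<forall>i<k. l (poly_app A (?X i) (w - poly_app A q x)) = 0" if "k \<le> d" for k w
      using that
    proof (induction k)
      case 0
      then show ?case by simp
    next
      case (Suc k)
      then obtain q where q: "\<And>i. i < k \<Longrightarrow> l (poly_app A (?X i) (w - poly_app A q x)) = 0" by auto
      define c where "c = l (poly_app A (?X k) (w - poly_app A q x)) / e"
      let ?q = "q + smult c (?X (d - 1 - k))"
      have "l (poly_app A (?X i) (w - poly_app A ?q x)) = 0" if "i < Suc k" for i
      proof -
        have "poly_app A (?X i) (w - poly_app A ?q x) =
          poly_app A (?X i) (w - poly_app A q x) - c *s poly_app A (?X (i + (d - 1 - k))) x"
          by (simp add: poly_app_add poly_app_smult poly_app_vec_add poly_app_vec_diff
            poly_app_vec_scale poly_app_mult[symmetric] mult_monom diff_diff_eq)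
        moreover have "l (poly_app A (?X (i + (d - 1 - k))) x) = (if i = k then e else 0)"
          using Suc.prems that by (subst lead) (auto simp: degree_monom_eq)
        ultimately show ?thesis
          using q[of i] that e by (auto simp: l.diff l.scale c_def)
      qed
      then show ?case by blast
    qed
    \<comment> \<open>The first \<open>d\<close> conditions imply all others, since \<open>s\<close>
      may be reduced modulo \<open>p\<close>.\<close>
    have "\<exists>q. w - poly_app A q x \<in> U" for w
    proof -
      obtain q where q: "\<And>i. i < d \<Longrightarrow> l (poly_app A (?X i) (w - poly_app A q x)) = 0"
        using ex[of d w] by blast
      have "l (poly_app A s (w - poly_app A q x)) = 0" for s
      proof -
        define r where "r = s mod p"
        have deg_r: "degree r < d" unfolding r_def using p False by (metis degree_mod_less' degree_0 neq0_conv)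
        have "s = s div p * p + r" unfolding r_def by simp
        then have s: "poly_app A s w = poly_app A r w" for w
          by (metis ann add.left_neutral p(3) poly_app_add poly_app_mult poly_app_vec_0)
        have "r = (\<Sum>i\<le>degree r. smult (coeff r i) (?X i))"
          by (simp add: smult_monom poly_as_sum_of_monoms)
        then have "poly_app A r u = (\<Sum>i\<le>degree r. coeff r i *s poly_app A (?X i) u)" for u
          by (metis (no_types, lifting) poly_app_smult poly_app_sum sum.cong)
        then show ?thesis using q deg_r by (simp add: s l.sum l.scale)
      qed
      then show ?thesis unfolding U_def by blast
    qed
    then obtain Q where Q: "\<And>w. w - poly_app A (Q w) x \<in> U" by metis
    define b where "b w = poly_app A (Q w) f" for w
    \<comment> \<open>Two choices of \<open>q\<close> differ by a polynomial sending
      \<open>x\<close> into \<open>U\<close>, which kills \<open>f\<close> by \<open>disj\<close>.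
      So any valid choice computes \<open>b w\<close>; linearity and commutation with
      \<open>A\<close> follow by exhibiting one.\<close>
    have b: "b w = poly_app A q f" if "w - poly_app A q x \<in> U" for w q
    proof -
      have "poly_app A (q - Q w) x \<in> U"
        using U_diff[OF Q[of w] that] by (simp add: poly_app_diff)
      from disj[OF this, of f] show ?thesis by (simp add: b_def poly_app_diff)
    qed
    have "Vector_Spaces.linear (*s) (*s) b"
    proof (rule Vector_Spaces.linear_iff[THEN iffD2], intro conjI allI vec.vector_space_axioms)
      fix v w c
      show "b (v + w) = b v + b w"
        unfolding b_def[of v] b_def[of w] poly_app_add[symmetric]
        by (rule b) (use U_add[OF Q[of v] Q[of w]] in \<open>simp add: poly_app_add algebra_simps\<close>)
      show "b (c *s v) = c *s b v"
        unfolding b_def[of v] poly_app_smult[symmetric]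
        by (rule b) (use U_scale[OF Q[of v], of c] in \<open>simp add: poly_app_smult vec.scale_right_diff_distrib\<close>)
    qed
    then have B: "matrix b *v w = b w" for w by (rule matrix_works)
    have "b (A *v w) = A *v b w" for w
    proof -
      have "b (A *v w) = poly_app A ([:0, 1:] * Q w) f"
        by (rule b) (use U_A[OF Q[of w]] in \<open>simp add: poly_app_mult vec.diff\<close>)
      then show ?thesis by (simp add: poly_app_mult b_def)
    qed
    then have "A ** matrix b = matrix b ** A"
      by (simp add: matrix_eq B matrix_vector_mul_assoc[symmetric])
    moreover have "matrix b *v x = f"
      unfolding B by (subst b[of _ 1]) (simp_all add: U_def)
    ultimately show ?thesis by blast
  qed
qed

subsection \<open>Generic vectors over a field extension\<close>

text \<open>Bezout's identity for \<open>p\<close> and a split polynomial, with the gcd kept split.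
  A root \<open>c\<close> of \<open>p\<close> contributes a common factor; otherwise
  \<open>p\<close> is invertible modulo \<open>[:-c, 1:]\<close> and \<open>c\<close> is
  dropped.\<close>

lemma bezout_linear_factors:
  fixes p :: "'a::field poly"
  shows "\<exists>a b ds. set ds \<subseteq> set cs \<and> a * p + b * (\<Prod>c\<leftarrow>cs. [:-c, 1:]) = (\<Prod>c\<leftarrow>ds. [:-c, 1:])
    \<and> (\<Prod>c\<leftarrow>ds. [:-c, 1:]) dvd p"
proof (induction cs arbitrary: p)
  case Nil
  show ?case by (rule exI[of _ 0], rule exI[of _ 1], rule exI[of _ "[]"]) simp
next
  case (Cons c cs)
  let ?P = "\<lambda>cs. \<Prod>c\<leftarrow>cs. [:-c, 1::'a:]" and ?l = "[:-c, 1:]"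
  show ?case
  proof (cases "poly p c = 0")
    case True
    then obtain q where p: "p = ?l * q" by (auto simp: poly_eq_0_iff_dvd)
    obtain a b ds where *: "set ds \<subseteq> set cs" "a * q + b * ?P cs = ?P ds" "?P ds dvd q"
      using Cons[of q] by blast
    have "a * p + b * ?P (c # cs) = ?l * (a * q + b * ?P cs)"
      unfolding p by (simp only: list.map prod_list.Cons algebra_simps)
    then have "a * p + b * ?P (c # cs) = ?P (c # ds)" using *(2) by simp
    moreover have "?P (c # ds) dvd p"
      using *(3) unfolding p by (simp only: list.map prod_list.Cons mult_dvd_mono dvd_refl)
    moreover have "set (c # ds) \<subseteq> set (c # cs)" using *(1) by auto
    ultimately show ?thesis by blast
  next
    case False
    define u where "u = inverse (poly p c)"
    obtain s where s: "p - [:poly p c:] = ?l * s"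
      using poly_eq_0_iff_dvd[of "p - [:poly p c:]" c] by auto
    have "[:u:] * [:poly p c:] = 1" using False by (simp add: u_def one_pCons)
    \<comment> \<open>This representation of 1 is inserted next to \<open>b\<close>; its last term
      supplies the factor \<open>?l\<close> missing from the product over \<open>cs\<close>.\<close>
    then have one: "1 = [:u:] * p - [:u:] * s * ?l" using s by algebra
    obtain a b ds where *: "set ds \<subseteq> set cs" "a * p + b * ?P cs = ?P ds" "?P ds dvd p"
      using Cons[of p] by blast
    have "(a + b * ?P cs * [:u:]) * p + (- (b * [:u:] * s)) * ?P (c # cs)
        = a * p + b * ?P cs * ([:u:] * p - [:u:] * s * ?l)"
      by (simp only: list.map prod_list.Cons) algebra
    also have "\<dots> = ?P ds" using *(2) by (simp only: one[symmetric] mult_1_right)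
    finally have "(a + b * ?P cs * [:u:]) * p + (- (b * [:u:] * s)) * ?P (c # cs) = ?P ds" .
    moreover have "set ds \<subseteq> set (c # cs)" using *(1) by auto
    ultimately show ?thesis using *(3) by blast
  qed
qed

text \<open>The product of annihilators of the standard basis vectors kills every vector and splits
  over an algebraically closed field; its nonzero leading coefficient cancels.\<close>

lemma exists_annihilating_linear_factors:
  fixes A :: "'a::alg_closed_field^'n^'n"
  shows "\<exists>cs. \<forall>v. poly_app A (\<Prod>c\<leftarrow>cs. [:-c, 1:]) v = 0"
proof -
  have "\<forall>i. \<exists>p. p \<noteq> 0 \<and> poly_app A p (axis i 1) = 0"
    using exists_annihilating_poly by blast
  from choice[OF this] obtain p where p: "\<And>i. p i \<noteq> 0" "\<And>i. poly_app A (p i) (axis i 1) = 0"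
    by blast
  let ?q = "\<Prod>i\<in>UNIV. p i"
  have ax: "poly_app A ?q (axis i 1) = 0" for i
  proof -
    have "?q = (\<Prod>j\<in>UNIV - {i}. p j) * p i" by (simp add: prod.remove[of _ i] mult.commute)
    then show ?thesis by (simp add: poly_app_mult p)
  qed
  have q0: "poly_app A ?q v = 0" for v
  proof -
    have "poly_app A ?q (\<Sum>i\<in>UNIV. (v $ i) *s axis i 1) = 0"
      unfolding poly_app_vec_sum poly_app_vec_scale ax by simp
    then show ?thesis by (simp only: basis_expansion)
  qed
  have "?q \<noteq> 0" using p by simp
  then obtain M where M: "?q = smult (lead_coeff ?q) (\<Prod>c\<in>#M. [:-c, 1:])"
    using alg_closed_imp_factorization by blast
  obtain cs where cs: "M = mset cs" by (metis ex_mset)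
  have "lead_coeff ?q *s poly_app A (\<Prod>c\<leftarrow>cs. [:-c, 1:]) v = 0" for v
  proof -
    have "?q = smult (lead_coeff ?q) (\<Prod>c\<leftarrow>cs. [:-c, 1:])"
      using M unfolding cs by (simp only: mset_map[symmetric] prod_mset_prod_list)
    then show ?thesis using q0[of v] by (simp only: poly_app_smult[symmetric])
  qed
  then show ?thesis using \<open>?q \<noteq> 0\<close> by (auto simp: vec.scale_eq_0_iff)
qed

section \<open>Matrices under a field embedding\<close>

lemma mat_mult_vec: "mat c *v v = c *s v" for c :: "'a::comm_semiring_1" and v :: "'a^'n"
  by (simp add: mat_def matrix_vector_mult_def vec_eq_iff if_distrib[of "\<lambda>x. x * _"] cong: if_cong)

definition map_mat :: "('a \<Rightarrow> 'b) \<Rightarrow> 'a^'n^'m \<Rightarrow> 'b^'n^'m" where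
  "map_mat h A = (\<chi> i j. h (A $ i $ j))"

locale field_embedding =
  fixes h :: "'k::field \<Rightarrow> 'l::field"
  assumes add: "h (a + b) = h a + h b" and mult: "h (a * b) = h a * h b"
    and one: "h 1 = 1"
begin

lemma zero [simp]: "h 0 = 0"
  by (metis add add_0_right add_left_cancel)

lemma minus: "h (- a) = - h a"
  using add[of a "- a"] by (simp add: eq_neg_iff_add_eq_0 add.commute)

lemma diff: "h (a - b) = h a - h b"
  using add[of a "- b"] by (simp add: minus)

lemma sum: "h (\<Sum>i\<in>I. f i) = (\<Sum>i\<in>I. h (f i))"
  by (induction I rule: infinite_finite_induct) (simp_all add: add)

text \<open>The large field as a vector space over the small one, in which matrix entries are later
  expanded.\<close>

sublocale vs: vector_space "\<lambda>c r. h c * r"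
  by unfold_locales (simp_all add: add mult one algebra_simps)

lemma map_mat_mult: "map_mat h (A ** B) = map_mat h A ** map_mat h B"
  by (simp add: map_mat_def matrix_matrix_mult_def vec_eq_iff sum mult)

text \<open>The same \<open>M\<close> serves both conjuncts, which is what transfers \<open>p(A) = 0\<close> between the two fields.\<close>

lemma poly_app_linear_factors:
  fixes A :: "'k^'n^'n"
  shows "\<exists>M. (\<forall>v. poly_app A (\<Prod>c\<leftarrow>cs. [:-c, 1:]) v = M *v v) \<and>
     (\<forall>v. poly_app (map_mat h A) (\<Prod>c\<leftarrow>cs. [:-h c, 1:]) v = map_mat h M *v v)"
proof (induction cs)
  case Nil
  have "map_mat h (mat 1) = (mat 1 :: 'l^'n^'n)"
    by (simp add: map_mat_def mat_def vec_eq_iff one)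
  then show ?case by (intro exI[of _ "mat 1"]) simp
next
  case (Cons c cs)
  then obtain M where M: "\<And>v. poly_app A (\<Prod>c\<leftarrow>cs. [:-c, 1:]) v = M *v v"
     "\<And>v. poly_app (map_mat h A) (\<Prod>c\<leftarrow>cs. [:-h c, 1:]) v = map_mat h M *v v" by blast
  let ?N = "A ** M - mat c ** M"
  have "map_mat h ?N = map_mat h A ** map_mat h M - mat (h c) ** map_mat h M"
    by (simp add: map_mat_mult[symmetric]) (simp add: map_mat_def matrix_matrix_mult_def mat_def
      vec_eq_iff diff sum mult if_distrib[of "\<lambda>x. x * _"] if_distrib[of h] cong: if_cong)
  then have "\<forall>v. poly_app (map_mat h A) (\<Prod>c\<leftarrow>c # cs. [:-h c, 1:]) v = map_mat h ?N *v v"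
    by (simp only: list.map prod_list.Cons poly_app_mult M poly_app_pCons)
       (simp add: matrix_vector_mul_assoc[symmetric] mat_mult_vec matrix_vector_mult_diff_rdistrib)
  moreover have "\<forall>v. poly_app A (\<Prod>c\<leftarrow>c # cs. [:-c, 1:]) v = ?N *v v"
    by (simp only: list.map prod_list.Cons poly_app_mult M poly_app_pCons)
       (simp add: matrix_vector_mul_assoc[symmetric] mat_mult_vec matrix_vector_mult_diff_rdistrib)
  ultimately show ?case by blast
qed

end

text \<open>
  Let \<open>m\<close> be a product of linear factors over the small field with \<open>m(A) = 0\<close>. Since \<open>p(A) x = 0\<close>,
  also \<open>g(A) x = 0\<close> for \<open>g = gcd p m\<close>. All roots of \<open>g\<close> lie in the small field, so
  genericity of \<open>x\<close> gives \<open>g(A) = 0\<close>.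
\<close>

lemma generic_vector_annihilator:
  fixes A :: "'k::alg_closed_field^'n^'n" and h :: "'k \<Rightarrow> 'l::field"
  assumes h: "field_embedding h"
    and generic: "\<And>M :: 'k^'n^'n. map_mat h M *v x = 0 \<Longrightarrow> M = 0"
    and p: "poly_app (map_mat h A) p x = 0"
  shows "poly_app (map_mat h A) p v = 0"
proof -
  interpret field_embedding h by (rule h)
  let ?A = "map_mat h A"
  let ?P = "\<lambda>cs. \<Prod>c\<leftarrow>cs. [:- c, 1:]"
  have map0: "map_mat h 0 = (0 :: 'l^'n^'n)" by (simp add: map_mat_def vec_eq_iff)
  obtain cs where cs: "\<And>v. poly_app A (?P cs) v = 0"
    using exists_annihilating_linear_factors[of A] by blast
  obtain M where M: "\<And>v. poly_app A (?P cs) v = M *v v"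
     "\<And>v. poly_app ?A (\<Prod>c\<leftarrow>cs. [:-h c, 1:]) v = map_mat h M *v v"
    using poly_app_linear_factors by blast
  have "M = 0" using cs M by (simp add: matrix_eq)
  then have ann: "poly_app ?A (?P (map h cs)) v = 0" for v
    using M(2) by (simp add: map0 comp_def)
  obtain a b es where ab: "set es \<subseteq> set (map h cs)" "a * p + b * ?P (map h cs) = ?P es"
      and dvd: "?P es dvd p"
    using bezout_linear_factors[of "map h cs" p] by blast
  have "es \<in> lists (h ` UNIV)" using ab(1) by auto
  then obtain ds where ds: "es = map h ds" by (auto simp: lists_image)
  obtain N where N: "\<And>v. poly_app A (?P ds) v = N *v v"
     "\<And>v. poly_app ?A (\<Prod>c\<leftarrow>ds. [:-h c, 1:]) v = map_mat h N *v v"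
    using poly_app_linear_factors by blast
  have es: "poly_app ?A (?P es) v = map_mat h N *v v" for v
    using N(2) by (simp add: ds comp_def)
  have "poly_app ?A (?P es) x = 0"
    unfolding ab(2)[symmetric] by (simp add: poly_app_add poly_app_mult p ann del: map_map)
  then have "N = 0" unfolding es by (rule generic)
  then have "poly_app ?A (?P es) v = 0" for v using es by (simp add: map0)
  moreover obtain q where "p = ?P es * q" using dvd by (rule dvdE)
  ultimately show ?thesis by (simp only: poly_app_mult)
qed

context field_embedding
begin

text \<open>Expand the entries of \<open>B\<close> in a basis, over the small field, of the space they span.\<close>

lemma commuting_matrix_decomposition:
  fixes A :: "'k^'n^'n" and B :: "'l^'n^'n"
  assumes comm: "map_mat h A ** B = B ** map_mat h A"
  shows "\<exists>\<Phi> C. finite \<Phi> \<and> (\<forall>\<phi>\<in>\<Phi>. A ** C \<phi> = C \<phi> ** A) \<and>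
    B = (\<Sum>\<phi>\<in>\<Phi>. mat \<phi> ** map_mat h (C \<phi>))"
proof -
  let ?E = "range (\<lambda>(i, j). B $ i $ j)"
  obtain \<Phi> where \<Phi>: "\<Phi> \<subseteq> ?E" "vs.independent \<Phi>" "?E \<subseteq> vs.span \<Phi>"
    using vs.maximal_independent_subset by blast
  have fin: "finite \<Phi>" using \<Phi>(1) by (rule finite_subset) simp
  define C :: "'l \<Rightarrow> 'k^'n^'n" where "C \<phi> = (\<chi> i j. vs.representation \<Phi> (B $ i $ j) \<phi>)" for \<phi>
  have B: "B $ i $ j = (\<Sum>\<phi>\<in>\<Phi>. h (C \<phi> $ i $ j) * \<phi>)" for i j
  proof -
    have "B $ i $ j \<in> vs.span \<Phi>" using \<Phi>(3) by auto
    from vs.sum_representation_eq[OF \<Phi>(2) this fin order_refl] show ?thesis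
      by (simp add: C_def)
  qed
  \<comment> \<open>Entrywise, \<open>comm\<close> is a linear relation among the elements of
    \<Phi>; its coefficients are the entries of \<open>A ** C \<phi> - C \<phi> ** A\<close>, so
    independence kills them.\<close>
  have "A ** C \<phi> = C \<phi> ** A" if "\<phi> \<in> \<Phi>" for \<phi>
  proof -
    have "(A ** C \<phi>) $ i $ j - (C \<phi> ** A) $ i $ j = 0" for i j
    proof (rule vs.independentD[OF \<Phi>(2) fin order_refl _ that])
      have "(\<Sum>\<phi>\<in>\<Phi>. h ((A ** C \<phi>) $ i $ j) * \<phi>) = (map_mat h A ** B) $ i $ j"
        unfolding matrix_matrix_mult_def map_mat_def
        by (simp add: B sum mult sum_distrib_left sum_distrib_right mult.assoc del: vs.scale_scale)
           (rule sum.swap)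
      moreover have "(\<Sum>\<phi>\<in>\<Phi>. h ((C \<phi> ** A) $ i $ j) * \<phi>) = (B ** map_mat h A) $ i $ j"
        unfolding matrix_matrix_mult_def map_mat_def
        by (simp add: B sum mult sum_distrib_left sum_distrib_right mult_ac del: vs.scale_scale)
           (rule sum.swap)
      ultimately show "(\<Sum>\<phi>\<in>\<Phi>. h ((A ** C \<phi>) $ i $ j - (C \<phi> ** A) $ i $ j) * \<phi>) = 0"
        using comm by (simp add: diff left_diff_distrib sum_subtractf)
    qed
    then show ?thesis by (simp add: vec_eq_iff)
  qed
  moreover have "B = (\<Sum>\<phi>\<in>\<Phi>. mat \<phi> ** map_mat h (C \<phi>))"
    by (simp add: vec_eq_iff B map_mat_def matrix_matrix_mult_def mat_def mult.commute
        if_distrib[of "\<lambda>x. x * _"] cong: if_cong)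
  ultimately show ?thesis using fin by blast
qed

end

text \<open>Whatever kills a generic \<open>x\<close> kills every vector, so some \<open>B\<close>
  over the large field commutes with the image of \<open>A\<close> and sends \<open>x\<close> to
  \<open>f\<close>. Its expansion over the small field is applied to \<open>x\<close>.\<close>

lemma generic_vector_span:
  fixes A :: "'k::alg_closed_field^'n^'n" and h :: "'k \<Rightarrow> 'l::field"
  assumes h: "field_embedding h"
    and generic: "\<And>M :: 'k^'n^'n. map_mat h M *v x = 0 \<Longrightarrow> M = 0"
  shows "f \<in> vec.span {map_mat h C *v x | C. A ** C = C ** A}"
proof -
  interpret field_embedding h by (rule h)
  obtain B where B: "map_mat h A ** B = B ** map_mat h A" "B *v x = f"
    using exists_commuting_matrix[of "map_mat h A" x f]
      generic_vector_annihilator[OF h generic] by blast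
  obtain \<Phi> C where C: "finite \<Phi>" "\<And>\<phi>. \<phi> \<in> \<Phi> \<Longrightarrow> A ** C \<phi> = C \<phi> ** A"
     "B = (\<Sum>\<phi>\<in>\<Phi>. mat \<phi> ** map_mat h (C \<phi>))"
    using commuting_matrix_decomposition[OF B(1)] by blast
  have "(\<Sum>\<phi>\<in>\<Phi>. M \<phi>) *v x = (\<Sum>\<phi>\<in>\<Phi>. M \<phi> *v x)" for M :: "'l \<Rightarrow> 'l^'n^'n"
    by (induction \<Phi> rule: infinite_finite_induct) (simp_all add: matrix_vector_mult_add_rdistrib)
  then have "f = (\<Sum>\<phi>\<in>\<Phi>. \<phi> *s (map_mat h (C \<phi>) *v x))"
    unfolding B(2)[symmetric] C(3) by (simp add: matrix_vector_mul_assoc[symmetric] mat_mult_vec)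
  also have "\<dots> \<in> vec.span {map_mat h C *v x | C. A ** C = C ** A}"
    by (intro vec.span_sum vec.span_scale vec.span_base) (use C(2) in blast)
  finally show ?thesis .
qed

text \<open>If solutions of \<open>E v = A v\<close> are linearly independent, applying \<open>E - A\<close> to a linear
  combination of them that is again a solution shows that all its coefficients are killed by \<open>E\<close>.\<close>

lemma span_solutions_constant_coeffs:
  fixes E :: "'a::field \<Rightarrow> 'a" and A :: "'a^'n^'n"
  assumes add: "\<And>p q. E (p + q) = E p + E q"
    and leibniz: "\<And>p q. E (p * q) = E p * q + p * E q"
    and S: "\<And>v i. v \<in> S \<Longrightarrow> E (v $ i) = (A *v v) $ i"
    and f: "f \<in> vec.span S" "\<And>i. E (f $ i) = (A *v f) $ i"
  shows "\<exists>B r. finite B \<and> B \<subseteq> S \<and> f = (\<Sum>v\<in>B. r v *s v) \<and> (\<forall>v\<in>B. E (r v) = 0)"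
proof -
  obtain B where B: "B \<subseteq> S" "vec.independent B" "S \<subseteq> vec.span B"
    using vec.maximal_independent_subset by blast
  have fin: "finite B" using B(2) by (rule vec.finiteI_independent)
  have "vec.span S \<subseteq> vec.span B" using B(3) vec.span_minimal vec.subspace_span by blast
  with f(1) have "f \<in> vec.span B" by blast
  from vec.sum_representation_eq[OF B(2) this fin order_refl]
  obtain r where r: "f = (\<Sum>v\<in>B. r v *s v)" by metis
  have "E 0 = 0" by (metis add add_0_right add_left_cancel)
  then have E_sum: "E (\<Sum>v\<in>B. g v) = (\<Sum>v\<in>B. E (g v))" for g
    by (induction B rule: infinite_finite_induct) (simp_all add: add)
  have "(\<Sum>v\<in>B. E (r v) *s v) $ i = 0" for i
  proof -
    have "E (f $ i) = (\<Sum>v\<in>B. E (r v) * v $ i) + (\<Sum>v\<in>B. r v * E (v $ i))"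
      by (simp add: r E_sum leibniz sum.distrib)
    also have "(\<Sum>v\<in>B. r v * E (v $ i)) = (\<Sum>v\<in>B. r v * (A *v v) $ i)"
      by (intro sum.cong refl) (use B(1) S in auto)
    also have "\<dots> = (A *v f) $ i"
      by (simp add: r vec.sum vec.scale)
    finally show ?thesis using f(2)[of i] by simp
  qed
  then have "(\<Sum>v\<in>B. E (r v) *s v) = 0" by (simp add: vec_eq_iff)
  then have "E (r v) = 0" if "v \<in> B" for v
    using vec.independentD[OF B(2) fin order_refl _ that, of "\<lambda>v. E (r v)"] by blast
  then show ?thesis using fin B(1) r by blast
qed

subsection \<open>Derivations and columns of rational functions\<close>

lemma Const_add: "Const (a + b) = Const a + Const b"
  by (simp add: Const_def single_add)

lemma Const_mult: "Const (a * b) = Const a * Const b"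
  by (simp add: Const_def mult_single)

lemma Const_1: "Const 1 = 1"
  by (simp add: Const_def single_one)

lemma field_embedding_ConstR: "field_embedding (ConstR :: 'k::field \<Rightarrow> ('n::linorder, 'k) ratfun)"
  by unfold_locales (simp_all add: ConstR_def Const_add Const_mult Const_1)

lemma derivation_add: "derivation h d \<Longrightarrow> d (p + q) = d p + d q"
  and derivation_scale: "derivation h d \<Longrightarrow> d (h c * p) = h c * d p"
  and derivation_mult: "derivation h d \<Longrightarrow> d (p * q) = d p * q + p * d q"
  unfolding derivation_def by blast+

lemma derivation_0: "derivation h d \<Longrightarrow> d 0 = 0"
  using derivation_add[of h d 0 0] by simp

lemma derivation_1: "derivation h d \<Longrightarrow> d 1 = 0"
  using derivation_mult[of h d 1 1] by (metis add_cancel_right_right mult_1_left mult_1_right)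

lemma derivation_const: "derivation h d \<Longrightarrow> d (h c) = 0"
  using derivation_scale[of h d c 1] by (simp add: derivation_1)

lemma derivation_sum: "derivation h d \<Longrightarrow> d (\<Sum>i\<in>I. f i) = (\<Sum>i\<in>I. d (f i))"
  by (induction I rule: infinite_finite_induct) (simp_all add: derivation_0 derivation_add)

text \<open>Mixed products such as \<open>S p * T q\<close> arise from both orders of composition
  and cancel. Vanishing of a bracket can then be tested on the variables.\<close>

lemma derivation_lie_bracket:
  assumes "derivation h S" "derivation h T"
  shows "derivation h (lie_bracket S T)"
proof -
  have scale: "S (h c * p) = h c * S p" "T (h c * p) = h c * T p" for c p
    using assms by (simp_all only: derivation_scale)
  have add: "S (p + q) = S p + S q" "T (p + q) = T p + T q" for p q
    using assms by (simp_all only: derivation_add)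
  have mult: "S (p * q) = S p * q + p * S q" "T (p * q) = T p * q + p * T q" for p q
    using assms by (simp_all only: derivation_mult)
  show ?thesis
    unfolding derivation_def lie_bracket_def
  proof (intro conjI allI)
    show "S (T (h c * p)) - T (S (h c * p)) = h c * (S (T p) - T (S p))" for c p
      by (simp only: scale right_diff_distrib)
  qed (simp_all add: add mult algebra_simps)
qed

text \<open>Induction on the total degree builds monomials one variable at a time. The cases match
  the rules that a derivation satisfies.\<close>

lemma mpoly_algebra_induct [case_names add scale one Var]:
  fixes p :: "('n::finite, 'k::field) mpoly"
  assumes add: "\<And>p q. P p \<Longrightarrow> P q \<Longrightarrow> P (p + q)"
    and scale: "\<And>c p. P p \<Longrightarrow> P (Const c * p)"
    and one: "P 1" and Var: "\<And>i p. P p \<Longrightarrow> P (Var i * p)"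
  shows "P p"
proof -
  have monom: "P (Poly_Mapping.single m 1)" for m
  proof (induction "\<Sum>i\<in>UNIV. Poly_Mapping.lookup m i" arbitrary: m)
    case 0
    then have "m = 0" by (intro poly_mapping_eqI) simp
    then show ?case using one by (simp add: single_one)
  next
    case (Suc N)
    then obtain i where i: "Poly_Mapping.lookup m i > 0"
      by (metis (no_types, lifting) neq0_conv sum.neutral Zero_not_Suc)
    let ?e = "Poly_Mapping.single i (1::nat)" and ?m = "m - Poly_Mapping.single i 1"
    \<comment> \<open>The subtraction is not truncated because the exponent of \<open>i\<close> is
      positive.\<close>
    have m: "m = ?e + ?m"
      using i by (intro poly_mapping_eqI) (auto simp: lookup_add lookup_minus lookup_single when_def)
    have "Poly_Mapping.lookup m j = (if j = i then 1 else 0) + Poly_Mapping.lookup ?m j" for j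
      by (subst m) (simp add: lookup_add lookup_single when_def)
    then have "(\<Sum>j\<in>UNIV. Poly_Mapping.lookup m j) =
        (\<Sum>j\<in>UNIV. (if j = i then 1 else 0) + Poly_Mapping.lookup ?m j)"
      by (intro sum.cong refl)
    also have "\<dots> = 1 + (\<Sum>j\<in>UNIV. Poly_Mapping.lookup ?m j)"
      by (simp add: sum.distrib)
    finally have "(\<Sum>j\<in>UNIV. Poly_Mapping.lookup m j) = 1 + (\<Sum>j\<in>UNIV. Poly_Mapping.lookup ?m j)" .
    then have "P (Poly_Mapping.single ?m 1)" using Suc by simp
    then have "P (Var i * Poly_Mapping.single ?m 1)" by (rule Var)
    also have "Var i * Poly_Mapping.single ?m 1 = Poly_Mapping.single m (1::'k)"
      by (subst (2) m) (simp only: Var_def mult_single mult_1_left)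
    finally show ?case .
  qed
  show ?thesis
  proof (induction p rule: mpoly_induct)
    case zero
    show ?case using scale[OF one, of 0] by (simp add: Const_def)
  next
    case (add_single m c p)
    have "P (Const c * Poly_Mapping.single m 1)" by (rule scale[OF monom])
    then have "P (Poly_Mapping.single m c)" by (simp add: Const_def mult_single)
    then show ?case using add_single by (rule add)
  qed
qed

lemma W_eqI:
  fixes d e :: "('n::finite, 'k::field) mpoly \<Rightarrow> ('n, 'k) mpoly"
  assumes "d \<in> W" "e \<in> W" and vars: "\<And>i. d (Var i) = e (Var i)"
  shows "d = e"
proof
  fix p
  have de: "derivation Const d" "derivation Const e" using assms by (simp_all add: W_def)
  show "d p = e p"
    by (induction p rule: mpoly_algebra_induct)
       (simp_all add: derivation_add[OF de(1)] derivation_add[OF de(2)] derivation_const[OF de(1)]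
         derivation_const[OF de(2)] derivation_1[OF de(1)] derivation_1[OF de(2)]
         derivation_mult[OF de(1)] derivation_mult[OF de(2)] vars)
qed

text \<open>Agreement on the variables gives agreement on polynomials; a fraction \<open>r\<close>
  is reached by the Leibniz rule on \<open>r * to_fract q = to_fract p\<close>.\<close>

lemma W_tilde_eqI:
  fixes d e :: "('n::{finite, linorder}, 'k::field) ratfun \<Rightarrow> ('n, 'k) ratfun"
  assumes "d \<in> W_tilde" "e \<in> W_tilde" and vars: "\<And>i. d (to_fract (Var i)) = e (to_fract (Var i))"
  shows "d = e"
proof
  fix r :: "('n, 'k) ratfun"
  have de: "derivation ConstR d" "derivation ConstR e" using assms by (simp_all add: W_tilde_def)
  have poly: "d (to_fract p) = e (to_fract p)" for p
    by (induction p rule: mpoly_algebra_induct)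
       (simp_all add: derivation_add[OF de(1)] derivation_add[OF de(2)]
         ConstR_def[symmetric] derivation_const[OF de(1)] derivation_const[OF de(2)]
         derivation_1[OF de(1)] derivation_1[OF de(2)]
         derivation_mult[OF de(1)] derivation_mult[OF de(2)] vars)
  obtain p q where r: "r = Fract p q" "q \<noteq> 0" by (cases r) auto
  then have rq: "r * to_fract q = to_fract p" by (simp add: Fract_conv_to_fract)
  have "d r * to_fract q + r * d (to_fract q) = e r * to_fract q + r * e (to_fract q)"
    unfolding derivation_mult[OF de(1), symmetric] derivation_mult[OF de(2), symmetric] rq
    by (rule poly)
  then show "d r = e r" using r(2) by (simp add: poly)
qed

lemma W_tilde_combination:
  assumes "\<And>T. T \<in> I \<Longrightarrow> T \<in> W_tilde"
  shows "(\<lambda>r. \<Sum>T\<in>I. \<phi> T * T r) \<in> W_tilde"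
proof -
  have *: "derivation ConstR T" if "T \<in> I" for T using assms[OF that] by (simp add: W_tilde_def)
  show ?thesis
    unfolding W_tilde_def derivation_def mem_Collect_eq
    by (intro conjI allI)
       (simp_all add: derivation_add[OF *] derivation_const[OF *] derivation_mult[OF *]
         sum.distrib sum_distrib_left sum_distrib_right algebra_simps)
qed

section \<open>Linear derivations and matrices\<close>

lemma linear_derivation_in_gl [simp]: "linear_derivation b \<in> gl"
  by (simp add: gl_def)

lemma linear_derivation_in_W [simp]: "linear_derivation b \<in> W"
  using gl_subset_W by auto

lemma linear_derivation_Var: "linear_derivation b (Var i) = (\<Sum>j\<in>UNIV. Const (b i j) * Var j)"
proof -
  have "linear_derivation b (Var i) =
      (\<Sum>k\<in>UNIV. if k = i then \<Sum>j\<in>UNIV. Const (b k j) * Var j else 0)"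
    unfolding linear_derivation_def partial_deriv_Var by (intro sum.cong) auto
  then show ?thesis by simp
qed

definition var_vec :: "(('n::{finite, linorder}, 'k::field) ratfun, 'n) vec" where
  "var_vec = (\<chi> i. to_fract (Var i))"

lemma extend_linear_derivation_Var:
  "extend (linear_derivation b) (to_fract (Var i)) = (map_mat ConstR (\<chi> i j. b i j) *v var_vec) $ i"
  by (simp add: extend_W linear_derivation_Var map_mat_def matrix_vector_mult_def var_vec_def ConstR_def)

text \<open>Each row of the product is a linear form in the variables;
  \<open>partial_deriv j\<close> extracts its coefficient at \<open>j\<close>.\<close>

lemma var_vec_generic:
  fixes M :: "(('k::field, 'n) vec, 'n::{finite, linorder}) vec"
  assumes "map_mat ConstR M *v var_vec = 0"
  shows "M = 0"
proof -
  have "M $ i $ j = 0" for i j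
  proof -
    have "(map_mat ConstR M *v var_vec) $ i = to_fract (\<Sum>l\<in>UNIV. Const (M $ i $ l) * Var l)"
      by (simp add: map_mat_def matrix_vector_mult_def var_vec_def ConstR_def)
    then have "to_fract (\<Sum>l\<in>UNIV. Const (M $ i $ l) * Var l) = (0 :: ('n, 'k) ratfun)"
      unfolding assms zero_index by (rule sym)
    then have 0: "(\<Sum>l\<in>UNIV. Const (M $ i $ l) * Var l) = (0 :: ('n, 'k) mpoly)"
      by (simp only: to_fract_eq_0_iff)
    have pd_sum: "partial_deriv j (\<Sum>l\<in>I. g l) = (\<Sum>l\<in>I. partial_deriv j (g l))"
      for g :: "'n \<Rightarrow> ('n, 'k) mpoly" and I
      by (induction I rule: infinite_finite_induct) (simp_all add: partial_deriv_add)
    have "partial_deriv j (\<Sum>l\<in>UNIV. Const (M $ i $ l) * Var l) = Const (M $ i $ j)"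
      by (simp add: pd_sum partial_deriv_mult partial_deriv_Var if_distrib[of "\<lambda>x. _ * x"] cong: if_cong)
    then have "Const (M $ i $ j) = (0 :: ('n, 'k) mpoly)" using 0 by simp
    then show ?thesis by (metis Const_def lookup_single_eq lookup_zero)
  qed
  then show ?thesis by (simp add: vec_eq_iff)
qed

lemma linear_derivation_in_centralizer:
  fixes a :: "'n::finite \<Rightarrow> 'n \<Rightarrow> 'k::field"
  assumes comm: "(\<chi> i j. a i j) ** C = C ** (\<chi> i j. a i j)"
  shows "linear_derivation (\<lambda>i j. C $ i $ j) \<in> centralizer gl (linear_derivation a)"
proof -
  let ?T = "linear_derivation (\<lambda>i j. C $ i $ j)" and ?D = "linear_derivation a"
  have der: "derivation Const (linear_derivation b)" for b :: "'n \<Rightarrow> 'n \<Rightarrow> 'k"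
    using linear_derivation_in_W[of b] by (simp add: W_def)
  \<comment> \<open>On the variables, composing linear derivations multiplies their matrices in
    reverse order.\<close>
  have ld: "linear_derivation b (linear_derivation c (Var i)) =
      (\<Sum>l\<in>UNIV. Const (((\<chi> i j. c i j) ** (\<chi> i j. b i j)) $ i $ l) * Var l)"
    for b c :: "'n \<Rightarrow> 'n \<Rightarrow> 'k" and i
  proof -
    have Const_sum: "Const (\<Sum>j\<in>J. g j) = (\<Sum>j\<in>J. Const (g j))" for J and g :: "'n \<Rightarrow> 'k"
      by (induction J rule: infinite_finite_induct) (simp_all add: Const_add, simp_all add: Const_def)
    show ?thesis
      by (simp add: linear_derivation_Var derivation_sum[OF der] derivation_scale[OF der]
         matrix_matrix_mult_def Const_sum Const_mult sum_distrib_left sum_distrib_right mult.assoc)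
         (rule sum.swap)
  qed
  have "lie_bracket ?T ?D = (\<lambda>_. 0)"
  proof (rule W_eqI)
    show "lie_bracket ?T ?D \<in> W" by (simp add: W_def derivation_lie_bracket der)
    show "(\<lambda>_. 0) \<in> W" by (simp add: W_def derivation_def)
    fix i
    show "lie_bracket ?T ?D (Var i) = 0"
      unfolding lie_bracket_def ld using comm by (simp add: vec_lambda_eta)
  qed
  then show ?thesis by (simp add: centralizer_def)
qed

section \<open>The two inclusions\<close>

text \<open>Commuting matrices serve twice: their columns \<open>C x\<close> express the values of
  \<open>t\<close> on the variables, and their linear derivations turn this into an identity of
  operators.\<close>

lemma centralizer_subset_span:
  fixes a :: "'n::{finite, linorder} \<Rightarrow> 'n \<Rightarrow> 'k::alg_closed_field"
  assumes t: "t \<in> centralizer W (linear_derivation a)"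
  shows "extend t \<in> span_over (constants (extend (linear_derivation a)))
    (extend ` centralizer gl (linear_derivation a))"
proof -
  let ?D = "linear_derivation a :: ('n, 'k) mpoly \<Rightarrow> _" and ?A = "\<chi> i j. a i j"
  let ?x = "var_vec :: (('n, 'k) ratfun, 'n) vec"
  define E where "E = extend ?D"
  have E: "derivation ConstR E" using extend_W(1)[of ?D] by (simp add: E_def W_tilde_def)
  have tW: "t \<in> W" and tD: "t (?D p) = ?D (t p)" for p
    using t by (auto simp: centralizer_def lie_bracket_def fun_eq_iff)
  have dt: "derivation Const t" using tW by (simp add: W_def)
  define f where "f = (\<chi> i. extend t (to_fract (Var i)))"
  let ?S = "{map_mat ConstR C *v ?x | C. ?A ** C = C ** ?A}"
  have "E (?x $ i) = (map_mat ConstR ?A *v ?x) $ i" for i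
    using extend_linear_derivation_Var[of a i] by (simp add: E_def var_vec_def)
  \<comment> \<open>The entries of \<open>C\<close> pass through \<open>E\<close> and
    \<open>C\<close> commutes with \<open>A\<close>, so \<open>C x\<close> inherits the equation
    from \<open>x\<close>.\<close>
  have S: "E (v $ i) = (map_mat ConstR ?A *v v) $ i" if v: "v \<in> ?S" for v i
  proof -
    interpret field_embedding "ConstR :: 'k \<Rightarrow> ('n, 'k) ratfun" by (rule field_embedding_ConstR)
    obtain C where C: "v = map_mat ConstR C *v ?x" "?A ** C = C ** ?A" using v by blast
    have "E (v $ i) = (\<Sum>j\<in>UNIV. ConstR (C $ i $ j) * E (?x $ j))"
      unfolding C(1) by (simp add: matrix_vector_mult_def derivation_sum[OF E] map_mat_def
        derivation_scale[OF E])
    also have "\<dots> = (map_mat ConstR C *v (map_mat ConstR ?A *v ?x)) $ i"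
      unfolding \<open>\<And>i. E (?x $ i) = _\<close> by (simp add: matrix_vector_mult_def map_mat_def)
    also have "map_mat ConstR C *v (map_mat ConstR ?A *v ?x) = map_mat ConstR ?A *v v"
      unfolding C(1) by (simp add: matrix_vector_mul_assoc map_mat_mult[symmetric] C(2))
    finally show ?thesis .
  qed
  \<comment> \<open>Since \<open>t\<close> commutes with \<open>D\<close>, \<open>E\<close> sends
    the entry \<open>t x_i\<close> to \<open>t (D x_i)\<close>, and \<open>t\<close> is linear over
    the ground field.\<close>
  have f: "E (f $ i) = (map_mat ConstR ?A *v f) $ i" for i
  proof -
    have "E (f $ i) = to_fract (t (?D (Var i)))"
      by (simp add: f_def E_def extend_W tW tD)
    then show ?thesis
      by (simp add: linear_derivation_Var derivation_sum[OF dt] derivation_scale[OF dt]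
        matrix_vector_mult_def map_mat_def f_def extend_W tW ConstR_def)
  qed
  have "\<exists>B r. finite B \<and> B \<subseteq> ?S \<and> f = (\<Sum>v\<in>B. r v *s v) \<and> (\<forall>v\<in>B. E (r v) = 0)"
    by (rule span_solutions_constant_coeffs[OF derivation_add[OF E] derivation_mult[OF E] S
      generic_vector_span[OF field_embedding_ConstR var_vec_generic] f])
  then obtain B r where B: "finite B" "B \<subseteq> ?S" "f = (\<Sum>v\<in>B. r v *s v)" "\<forall>v\<in>B. E (r v) = 0"
    by (elim exE conjE)
  have "\<forall>v\<in>B. \<exists>C. v = map_mat ConstR C *v ?x \<and> ?A ** C = C ** ?A" using B(2) by blast
  from bchoice[OF this] obtain C where
    C: "\<And>v. v \<in> B \<Longrightarrow> v = map_mat ConstR (C v) *v ?x" "\<And>v. v \<in> B \<Longrightarrow> ?A ** C v = C v ** ?A"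
    by blast
  define \<tau> where "\<tau> v = extend (linear_derivation (\<lambda>i j. C v $ i $ j) :: ('n, 'k) mpoly \<Rightarrow> _)" for v
  \<comment> \<open>\<open>span_over\<close> indexes coefficients by operators; \<open>vals\<close>
    recovers the column \<open>v\<close> from \<open>\<tau> v\<close>, so \<open>r\<close> can be
    transported.\<close>
  define vals where "vals T = (\<chi> i. T (to_fract (Var i)))"
    for T :: "('n, 'k) ratfun \<Rightarrow> ('n, 'k) ratfun"
  have \<tau>: "\<tau> v (to_fract (Var i)) = v $ i" if "v \<in> B" for v i
    by (subst (2) C(1)[OF that]) (simp add: \<tau>_def extend_linear_derivation_Var vec_lambda_eta)
  then have vals: "vals (\<tau> v) = v" if "v \<in> B" for v
    using that by (simp add: vals_def vec_lambda_eta)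
  have inj: "inj_on \<tau> B" by (rule inj_on_inverseI[of _ vals]) (rule vals)
  have "extend t = (\<lambda>s. \<Sum>T\<in>\<tau> ` B. r (vals T) * T s)"
  proof (rule W_tilde_eqI)
    show "extend t \<in> W_tilde" using tW by (rule extend_W)
    show "(\<lambda>s. \<Sum>T\<in>\<tau> ` B. r (vals T) * T s) \<in> W_tilde"
      by (rule W_tilde_combination) (auto simp: \<tau>_def extend_W)
    fix i
    have "(\<Sum>T\<in>\<tau> ` B. r (vals T) * T (to_fract (Var i))) = (\<Sum>v\<in>B. r v * v $ i)"
      unfolding sum.reindex[OF inj] by (intro sum.cong refl) (simp add: vals \<tau>)
    also have "\<dots> = f $ i" unfolding B(3) by simp
    finally show "extend t (to_fract (Var i)) = (\<Sum>T\<in>\<tau> ` B. r (vals T) * T (to_fract (Var i)))"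
      by (simp add: f_def)
  qed
  moreover have "\<tau> ` B \<subseteq> extend ` centralizer gl ?D"
    unfolding \<tau>_def using C(2) linear_derivation_in_centralizer by blast
  moreover have "\<forall>T\<in>\<tau> ` B. r (vals T) \<in> constants E"
    by (simp add: constants_def vals B(4))
  ultimately show ?thesis
    unfolding span_over_def E_def using B(1)
    by (intro CollectI exI[of _ "\<tau> ` B"] exI[of _ "\<lambda>T. r (vals T)"]) simp
qed

text \<open>Constants of \<open>extend D\<close> pass through it, so \<open>extend t\<close>
  commutes with \<open>extend D\<close> on polynomials; injectivity of \<open>to_fract\<close>
  brings this back to \<open>t\<close> and \<open>D\<close>.\<close>

lemma span_subset_centralizer:
  assumes D: "D \<in> W" and t: "t \<in> W"
    and span: "extend t \<in> span_over (constants (extend D)) (extend ` centralizer W D)"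
  shows "t \<in> centralizer W D"
proof -
  let ?E = "extend D"
  have E: "derivation ConstR ?E" using extend_W(1)[OF D] by (simp add: W_tilde_def)
  obtain I \<phi> where I: "extend t = (\<lambda>r. \<Sum>T\<in>I. \<phi> T * T r)" "I \<subseteq> extend ` centralizer W D"
      "\<And>T. T \<in> I \<Longrightarrow> ?E (\<phi> T) = 0"
    using span by (auto simp: span_over_def constants_def)
  have comm: "T (to_fract (D p)) = ?E (T (to_fract p))" if T: "T \<in> I" for T p
  proof -
    obtain s where s: "T = extend s" "s \<in> W" "lie_bracket s D = (\<lambda>_. 0)"
      using I(2) T unfolding centralizer_def by blast
    then have "s (D p) = D (s p)" by (simp add: lie_bracket_def fun_eq_iff)
    then show ?thesis using s D by (simp add: extend_W)
  qed
  have "t (D p) = D (t p)" for p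
  proof -
    have "to_fract (D (t p)) = ?E (extend t (to_fract p))" by (simp add: extend_W D t)
    also have "\<dots> = (\<Sum>T\<in>I. \<phi> T * ?E (T (to_fract p)))"
      unfolding I(1) by (simp add: derivation_sum[OF E] derivation_mult[OF E] I(3))
    also have "\<dots> = (\<Sum>T\<in>I. \<phi> T * T (to_fract (D p)))" by (simp add: comm)
    also have "\<dots> = extend t (to_fract (D p))" by (simp add: I(1))
    also have "\<dots> = to_fract (t (D p))" by (simp add: extend_W t)
    finally show ?thesis by simp
  qed
  then show ?thesis using t by (simp add: centralizer_def lie_bracket_def)
qed

text \<open>Scalars from \<open>F\<close> act only on operators on rational functions, so both sides
  are formed there and polynomial derivations enter through \<open>extend\<close>.\<close>

theorem theorem1:
  fixes a :: "'n::{finite, linorder} \<Rightarrow> 'n \<Rightarrow> 'k::{alg_closed_field, field_char_0}"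
    and D :: "('n, 'k) mpoly \<Rightarrow> ('n, 'k) mpoly"
    and F :: "('n, 'k) ratfun set"
  assumes D: "D = linear_derivation a"
    and F: "F = constants (extend D)"
  shows "extend ` centralizer W D = span_over F (extend ` centralizer gl D) \<inter> extend ` W"
proof (intro equalityI subsetI)
  fix T assume "T \<in> extend ` centralizer W D"
  then obtain t where "T = extend t" "t \<in> centralizer W D" by blast
  then show "T \<in> span_over F (extend ` centralizer gl D) \<inter> extend ` W"
    using centralizer_subset_span[of t a] by (auto simp: D F centralizer_def)
next
  fix T assume T: "T \<in> span_over F (extend ` centralizer gl D) \<inter> extend ` W"
  then obtain t where t: "T = extend t" "t \<in> W" by blast
  have "centralizer gl D \<subseteq> centralizer W D"
    using gl_subset_W by (auto simp: centralizer_def)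
  then have "T \<in> span_over F (extend ` centralizer W D)"
    using T unfolding span_over_def by blast
  then show "T \<in> extend ` centralizer W D"
    using span_subset_centralizer[of D t] t by (simp add: D F)
qed

end
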